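(* Assume that the constraints $G_iq_i+H_iu_i\leq h_i$ include the bounds $\underline{q}_iu_{it}\leq q_{it}\leq \overline{q}_iu_{it}$. Then the following are valid inequalities for the optimality system (OS): for all $t=1,\dots,T$, $i=1,\dots,I$, $j=1,\dots,J$ with $u_{it}^j=1$, $$q_{it}^j-(\overline{q}_i-\underline{q}_i)\Big(\sum_{(k,s)\neq (i,t):\,u_{ks}^j=1}(1-u_{ks})+\sum_{(k,s):\,u_{ks}^j=0}u_{ks}\Big)-\overline{q}_i(1-u_{it})\ \leq\ q_{it}$$ and $$q_{it}\ \leq\ q_{it}^j+(\overline{q}_i-\underline{q}_i)\Big(\sum_{(k,s)\neq (i,t):\,u_{ks}^j=1}(1-u_{ks})+\sum_{(k,s):\,u_{ks}^j=0}u_{ks}\Big)-\underline{q}_i(1-u_{it}).$$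
   Context: Let $I,T,m,n$ be positive integers. Units are indexed by $i=1,\dots,I$ and time periods by $t=1,\dots,T$. Write $u=(u_{it}),q=(q_{it})\in\mathbb{R}^{IT}$, with $u_i=(u_{i1},\dots,u_{iT})^\top$, $q_i=(q_{i1},\dots,q_{iT})^\top$ and $q_t=(q_{1t},\dots,q_{It})^\top$; similarly for $u^j,q^j$. Sums over $(k,s)$ range over $k\in\{1,\dots,I\}$, $s\in\{1,\dots,T\}$. The constants $\underline q_i$ and $\overline q_i$ are lower and upper bounds on the production of unit $i$ when committed. For each $t$, $P_t:\mathbb{R}^I\to\mathbb{R}$ is concave and continuously differentiable. For each $i$, $C_i:\mathbb{R}\to\mathbb{R}$ is convex and continuously differentiable, $S_i:\mathbb{R}^T\to\mathbb{R}$ is continuous, $A_i\in\mathbb{R}^{n\times T}$, $b_i\in\mathbb{R}^n$, $G_i,H_i\in\mathbb{R}^{m\times T}$, $h_i\in\mathbb{R}^m$, and $g_{it}$ is the $t$-th column of $G_i$. Let $u^1,\dots,u^J$ enumerate $\{u\in\{0,1\}^{IT}: A_iu_i\leq b_i,\ i=1,\dots,I\}$. The optimality system (OS), in the unknowns $q,u\in\mathbb{R}^{IT}$, $q^j\in\mathbb{R}^{IT}$, $\lambda_i^j\in\mathbb{R}^m$, consists of $$G_iq_i+H_iu_i\leq h_i,\ A_iu_i\leq b_i,\ u_i\in\{0,1\}^T,\quad i=1,\dots,I,$$ $$\sum_{t}P_t(q_{t})-\sum_{i}\sum_{t}C_i(q_{it})-\sum_{i}S_i(u_i)\geq \sum_{t}P_t(q_{t}^{j})-\sum_{i}\sum_{t}C_i(q_{it}^j)-\sum_{i}S_i(u_i^j),\quad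 j=1,\dots,J,$$ $$-\frac{\partial P_t}{\partial q_{it}}(q_t^j)+\frac{dC_i}{dq_{it}}(q_{it}^j)+(\lambda_{i}^j)^\top g_{it}=0,\ t=1,\dots,T,\quad 0\leq \lambda_i^j\perp h_i-G_iq_i^j-H_iu_i^j\geq 0,\quad i=1,\dots,I,\ j=1,\dots,J,$$ where $0\le x\perp y\ge 0$ means $x,y\ge 0$ componentwise and $x^\top y=0$. It characterises the optimal solutions $(q,u)$ of the problem of maximising $\sum_{t}P_t(q_{t})-\sum_{i}\sum_{t}C_i(q_{it})-\sum_{i}S_i(u_i)$ subject to the first line of constraints; that problem is assumed to be feasible and bounded such that it has an optimal solution.
   Formalization: For u^j = u the inequalities can fail if the optimal production is not unique; they are proved for all (OS) solutions when u^j ≠ u, after re-choosing q^j (same q, u, λ) when u^j = u, and for every solution if the optimal production for each u^j is unique. *)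

theory Defs
  imports "HOL-Analysis.Analysis"
begin

text \<open>
  Units are indexed by the finite type \<open>'i\<close>, periods by \<open>'t\<close>, the rows of \<open>G\<^sub>i, H\<^sub>i, h\<^sub>i\<close> by \<open>'m\<close>
  and those of \<open>A\<^sub>i, b\<^sub>i\<close> by \<open>'n\<close>.  A plan \<open>q :: real^'t^'i\<close> has entries \<open>q $ i $ t\<close>, so
  \<open>q $ i\<close> is \<open>q\<^sub>i\<close> and \<open>column t q\<close> is \<open>q\<^sub>t\<close>; likewise \<open>column t (G i)\<close> is \<open>g\<^sub>i\<^sub>t\<close>.
  Inequalities between vectors are componentwise.
\<close>

definition partial_deriv :: "'i::finite \<Rightarrow> (real^'i \<Rightarrow> real) \<Rightarrow> real^'i \<Rightarrow> real" where
  "partial_deriv i f x = deriv (\<lambda>s. f (\<chi> k. if k = i then s else x $ k)) (x $ i)"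

definition cont_differentiable :: "(real^'i::finite \<Rightarrow> real) \<Rightarrow> bool" where
  "cont_differentiable f \<longleftrightarrow>
     f differentiable_on UNIV \<and> (\<forall>i. continuous_on UNIV (partial_deriv i f))"

definition objective ::
  "('t::finite \<Rightarrow> real^'i::finite \<Rightarrow> real) \<Rightarrow> ('i \<Rightarrow> real \<Rightarrow> real) \<Rightarrow> ('i \<Rightarrow> real^'t \<Rightarrow> real)
   \<Rightarrow> real^'t^'i \<Rightarrow> real^'t^'i \<Rightarrow> real" where
  "objective P C S q u =
     (\<Sum>t\<in>UNIV. P t (column t q)) - (\<Sum>i\<in>UNIV. \<Sum>t\<in>UNIV. C i (q $ i $ t))
       - (\<Sum>i\<in>UNIV. S i (u $ i))"

definition commitments ::
  "('i::finite \<Rightarrow> real^'t::finite^'n::finite) \<Rightarrow> ('i \<Rightarrow> real^'n) \<Rightarrow> (real^'t^'i) set" where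
  "commitments A b = {u. (\<forall>i t. u $ i $ t \<in> {0, 1}) \<and> (\<forall>i. A i *v (u $ i) \<le> b i)}"

definition production_feasible ::
  "('i::finite \<Rightarrow> real^'t::finite^'m::finite) \<Rightarrow> ('i \<Rightarrow> real^'t^'m) \<Rightarrow> ('i \<Rightarrow> real^'m)
   \<Rightarrow> real^'t^'i \<Rightarrow> real^'t^'i \<Rightarrow> bool" where
  "production_feasible G H h q u \<longleftrightarrow> (\<forall>i. G i *v (q $ i) + H i *v (u $ i) \<le> h i)"

definition optimal_solution ::
  "('t::finite \<Rightarrow> real^'i::finite \<Rightarrow> real) \<Rightarrow> ('i \<Rightarrow> real \<Rightarrow> real) \<Rightarrow> ('i \<Rightarrow> real^'t \<Rightarrow> real)
   \<Rightarrow> ('i \<Rightarrow> real^'t^'n::finite) \<Rightarrow> ('i \<Rightarrow> real^'n)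
   \<Rightarrow> ('i \<Rightarrow> real^'t^'m::finite) \<Rightarrow> ('i \<Rightarrow> real^'t^'m) \<Rightarrow> ('i \<Rightarrow> real^'m)
   \<Rightarrow> real^'t^'i \<Rightarrow> real^'t^'i \<Rightarrow> bool" where
  "optimal_solution P C S A b G H h q u \<longleftrightarrow>
     u \<in> commitments A b \<and> production_feasible G H h q u \<and>
     (\<forall>q' u'. u' \<in> commitments A b \<and> production_feasible G H h q' u'
        \<longrightarrow> objective P C S q' u' \<le> objective P C S q u)"

definition optimal_production ::
  "('t::finite \<Rightarrow> real^'i::finite \<Rightarrow> real) \<Rightarrow> ('i \<Rightarrow> real \<Rightarrow> real) \<Rightarrow> ('i \<Rightarrow> real^'t \<Rightarrow> real)
   \<Rightarrow> ('i \<Rightarrow> real^'t^'m::finite) \<Rightarrow> ('i \<Rightarrow> real^'t^'m) \<Rightarrow> ('i \<Rightarrow> real^'m)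
   \<Rightarrow> real^'t^'i \<Rightarrow> real^'t^'i \<Rightarrow> bool" where
  "optimal_production P C S G H h u q \<longleftrightarrow>
     production_feasible G H h q u \<and>
     (\<forall>q'. production_feasible G H h q' u \<longrightarrow> objective P C S q' u \<le> objective P C S q u)"

definition complementary :: "real^'m::finite \<Rightarrow> real^'m \<Rightarrow> bool" where
  "complementary x y \<longleftrightarrow> 0 \<le> x \<and> 0 \<le> y \<and> x \<bullet> y = 0"

text \<open>
  The optimality system in the unknowns \<open>q\<close>, \<open>u\<close>, \<open>qq j\<close> (for \<open>q\<^sup>j\<close>) and \<open>lam j i\<close> (for
  \<open>\<lambda>\<^sub>i\<^sup>j\<close>); \<open>uu j\<close> is the given vector \<open>u\<^sup>j\<close>.  Values of \<open>uu\<close>, \<open>qq\<close>, \<open>lam\<close> at indices outside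
  \<open>{1..J}\<close> play no role.
\<close>

definition OS ::
  "('t::finite \<Rightarrow> real^'i::finite \<Rightarrow> real) \<Rightarrow> ('i \<Rightarrow> real \<Rightarrow> real) \<Rightarrow> ('i \<Rightarrow> real^'t \<Rightarrow> real)
   \<Rightarrow> ('i \<Rightarrow> real^'t^'n::finite) \<Rightarrow> ('i \<Rightarrow> real^'n)
   \<Rightarrow> ('i \<Rightarrow> real^'t^'m::finite) \<Rightarrow> ('i \<Rightarrow> real^'t^'m) \<Rightarrow> ('i \<Rightarrow> real^'m)
   \<Rightarrow> nat \<Rightarrow> (nat \<Rightarrow> real^'t^'i)
   \<Rightarrow> real^'t^'i \<Rightarrow> real^'t^'i \<Rightarrow> (nat \<Rightarrow> real^'t^'i) \<Rightarrow> (nat \<Rightarrow> 'i \<Rightarrow> real^'m) \<Rightarrow> bool" where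
  "OS P C S A b G H h J uu q u qq lam \<longleftrightarrow>
     u \<in> commitments A b \<and> production_feasible G H h q u \<and>
     (\<forall>j\<in>{1..J}. objective P C S q u \<ge> objective P C S (qq j) (uu j)) \<and>
     (\<forall>j\<in>{1..J}. \<forall>i.
        (\<forall>t. - partial_deriv i (P t) (column t (qq j)) + deriv (C i) (qq j $ i $ t)
               + lam j i \<bullet> column t (G i) = 0) \<and>
        complementary (lam j i) (h i - G i *v (qq j $ i) - H i *v (uu j $ i)))"

text \<open>
  For every unit \<open>i\<close> and period \<open>t\<close>, one row of \<open>G\<^sub>i x + H\<^sub>i v \<le> h\<^sub>i\<close> is (up to scaling) the
  inequality \<open>qlo\<^sub>i v\<^sub>t \<le> x\<^sub>t\<close> and one row is \<open>x\<^sub>t \<le> qhi\<^sub>i v\<^sub>t\<close>.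
\<close>

definition includes_bounds ::
  "('i::finite \<Rightarrow> real^'t::finite^'m::finite) \<Rightarrow> ('i \<Rightarrow> real^'t^'m) \<Rightarrow> ('i \<Rightarrow> real^'m)
   \<Rightarrow> ('i \<Rightarrow> real) \<Rightarrow> ('i \<Rightarrow> real) \<Rightarrow> bool" where
  "includes_bounds G H h qlo qhi \<longleftrightarrow>
     (\<forall>i t.
        (\<exists>r. \<forall>x v :: real^'t. (G i *v x + H i *v v) $ r \<le> h i $ r \<longleftrightarrow> qlo i * v $ t \<le> x $ t) \<and>
        (\<exists>r. \<forall>x v :: real^'t. (G i *v x + H i *v v) $ r \<le> h i $ r \<longleftrightarrow> x $ t \<le> qhi i * v $ t))"

definition deviation :: "real^'t::finite^'i::finite \<Rightarrow> real^'t^'i \<Rightarrow> 'i \<Rightarrow> 't \<Rightarrow> real" where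
  "deviation uj u i t =
     (\<Sum>(k, s) \<in> {(k, s). (k, s) \<noteq> (i, t) \<and> uj $ k $ s = 1}. 1 - u $ k $ s)
     + (\<Sum>(k, s) \<in> {(k, s). uj $ k $ s = 0}. u $ k $ s)"

text \<open>
  Without uniqueness of the optimal production for a fixed commitment, a solution of the system may
  have \<open>uu j = u\<close> but \<open>qq j \<noteq> q\<close> (both being optimal for \<open>u\<close>), and then these inequalities can
  fail.  So in general they are valid in the sense that they remove no pair \<open>(q, u)\<close> from the
  system: only the copy \<open>qq j\<close> with \<open>uu j = u\<close> may have to be chosen anew.
\<close>

definition linking_inequalities ::
  "('i::finite \<Rightarrow> real) \<Rightarrow> ('i \<Rightarrow> real) \<Rightarrow> nat \<Rightarrow> (nat \<Rightarrow> real^'t::finite^'i)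
   \<Rightarrow> real^'t^'i \<Rightarrow> real^'t^'i \<Rightarrow> (nat \<Rightarrow> real^'t^'i) \<Rightarrow> bool" where
  "linking_inequalities qlo qhi J uu q u qq \<longleftrightarrow>
     (\<forall>t i. \<forall>j\<in>{1..J}. uu j $ i $ t = 1 \<longrightarrow>
        qq j $ i $ t - (qhi i - qlo i) * deviation (uu j) u i t - qhi i * (1 - u $ i $ t)
          \<le> q $ i $ t \<and>
        q $ i $ t
          \<le> qq j $ i $ t + (qhi i - qlo i) * deviation (uu j) u i t - qlo i * (1 - u $ i $ t))"

end

theory Submission
  imports Defs
begin

text \<open>
  For the index \<open>j\<close> with \<open>u\<^sup>j = u\<close>, both \<open>q\<close> and \<open>q\<^sup>j\<close> maximise the concave objective over the
  productions feasible for \<open>u\<close>.  The Lagrangian with multipliers \<open>\<lambda>\<^sup>j\<close> is concave and maximised at \<open>q\<^sup>j\<close>;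
  as \<open>q\<close> has no smaller Lagrangian value, it is a maximiser as well, so \<open>q\<close> satisfies the KKT conditions
  with the same multipliers and may replace \<open>q\<^sup>j\<close>.  For \<open>u\<^sup>j \<noteq> u\<close> with \<open>u\<^sub>i\<^sub>t = 1\<close> the deviation is at
  least 1, so the inequalities follow from the production bounds; with \<open>u\<^sub>i\<^sub>t = 0\<close> the bounds force
  \<open>q\<^sub>i\<^sub>t = 0\<close>.
\<close>

section \<open>Partial derivatives and the tangent inequality for concave functions\<close>

lemma partial_deriv_eq_derivative:
  fixes f :: "real^'i::finite \<Rightarrow> real"
  assumes "(f has_derivative D) (at x)"
  shows "partial_deriv i f x = D (axis i 1)"
proof -
  \<comment> \<open>Replacing one coordinate is a walk along the line through \<open>x\<close> in
    direction \<open>axis i 1\<close>, so the chain rule applies.\<close>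
  have eq: "(\<chi> k. if k = i then s else x $ k) = x + (s - x $ i) *\<^sub>R axis i 1" for s :: real
    by (simp add: vec_eq_iff axis_def)
  have "((\<lambda>s. x + (s - x $ i) *\<^sub>R axis i 1) has_derivative (\<lambda>s. s *\<^sub>R axis i 1)) (at (x $ i))"
    by (auto intro!: derivative_eq_intros)
  moreover have "(f has_derivative D) (at (x + (x $ i - x $ i) *\<^sub>R axis i 1))"
    using assms by simp
  ultimately have "((\<lambda>s. f (x + (s - x $ i) *\<^sub>R axis i 1)) has_derivative (\<lambda>s. D (s *\<^sub>R axis i 1))) (at (x $ i))"
    by (rule has_derivative_compose)
  then have "((\<lambda>s. f (x + (s - x $ i) *\<^sub>R axis i 1)) has_field_derivative D (axis i 1)) (at (x $ i))"
    using linear_scale[OF has_derivative_linear[OF assms]]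
    by (simp add: has_field_derivative_def mult_commute_abs)
  then show ?thesis
    unfolding partial_deriv_def eq by (rule DERIV_imp_deriv)
qed

text \<open>Expanding \<open>v\<close> in the standard basis recovers the linear derivative from the
  coordinate derivatives in which \<open>OS\<close> is phrased.\<close>

lemma has_derivative_partial_deriv:
  fixes f :: "real^'i::finite \<Rightarrow> real"
  assumes "f differentiable at x"
  shows "(f has_derivative (\<lambda>v. \<Sum>i\<in>UNIV. v $ i * partial_deriv i f x)) (at x)"
proof -
  obtain D where D: "(f has_derivative D) (at x)"
    using assms by (auto simp: differentiable_def)
  interpret linear D by (rule has_derivative_linear[OF D])
  have "D v = (\<Sum>i\<in>UNIV. v $ i * partial_deriv i f x)" for v
  proof -
    have "v = (\<Sum>i\<in>UNIV. v $ i *\<^sub>R axis i 1)"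
      using basis_expansion[of v] by (simp add: scalar_mult_eq_scaleR)
    then have "D v = D (\<Sum>i\<in>UNIV. v $ i *\<^sub>R axis i 1)" by simp
    then show ?thesis
      by (simp add: sum scale partial_deriv_eq_derivative[OF D])
  qed
  then have "D = (\<lambda>v. \<Sum>i\<in>UNIV. v $ i * partial_deriv i f x)" by blast
  with D show ?thesis by simp
qed

text \<open>Along the line through \<open>x\<close> and \<open>y\<close>, the function
  \<open>- f\<close> becomes convex in one real variable; its tangent inequality at 0, evaluated at
  1, is the claim.\<close>

lemma concave_on_below_tangent:
  fixes f :: "'a::real_normed_vector \<Rightarrow> real"
  assumes "concave_on UNIV f" and D: "(f has_derivative D) (at x)"
  shows "f y \<le> f x + D (y - x)"
proof -
  let ?\<phi> = "\<lambda>s. - f (x + s *\<^sub>R (y - x))"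
  have cvx: "convex_on UNIV (\<lambda>z. - f z)"
    using assms(1) by (simp add: concave_on_def)
  have "convex_on UNIV ?\<phi>"
  proof (rule convex_onI)
    fix c a b :: real assume "0 < c" "c < 1"
    have "x + ((1 - c) *\<^sub>R a + c *\<^sub>R b) *\<^sub>R (y - x)
        = (1 - c) *\<^sub>R (x + a *\<^sub>R (y - x)) + c *\<^sub>R (x + b *\<^sub>R (y - x))"
      by (simp add: algebra_simps)
    then show "?\<phi> ((1 - c) *\<^sub>R a + c *\<^sub>R b) \<le> (1 - c) * ?\<phi> a + c * ?\<phi> b"
      using convex_onD[OF cvx, of c "x + a *\<^sub>R (y - x)" "x + b *\<^sub>R (y - x)"] \<open>0 < c\<close> \<open>c < 1\<close>
      by simp
  qed simp
  moreover have "(?\<phi> has_field_derivative - D (y - x)) (at 0)"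
  proof -
    have "((\<lambda>s. x + s *\<^sub>R (y - x)) has_derivative (\<lambda>s. s *\<^sub>R (y - x))) (at (0::real))"
      by (auto intro!: derivative_eq_intros)
    moreover have "(f has_derivative D) (at (x + (0::real) *\<^sub>R (y - x)))"
      using D by simp
    ultimately have "((\<lambda>s. f (x + s *\<^sub>R (y - x))) has_derivative (\<lambda>s. D (s *\<^sub>R (y - x)))) (at (0::real))"
      by (rule has_derivative_compose)
    then have "((\<lambda>s. f (x + s *\<^sub>R (y - x))) has_field_derivative D (y - x)) (at 0)"
      using linear_scale[OF has_derivative_linear[OF D]]
      by (simp add: has_field_derivative_def mult_commute_abs)
    then show ?thesis by (rule DERIV_minus)
  qed
  ultimately have "?\<phi> 1 - ?\<phi> 0 \<ge> - D (y - x) * (1 - 0)"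
    by (intro convex_on_imp_above_tangent[where A = UNIV]) auto
  then show ?thesis by simp
qed

section \<open>The Lagrangian of the production problem for a fixed commitment\<close>

lemma convex_on_sum_fun:
  assumes "convex X" and "\<And>a. a \<in> A \<Longrightarrow> convex_on X (f a)"
  shows "convex_on X (\<lambda>x. \<Sum>a\<in>A. f a x)"
  using assms(2)
  by (induction A rule: infinite_finite_induct) (simp_all add: convex_on_add convex_on_const assms(1))

text \<open>The problem is a maximisation, so the slacks enter with a plus sign: nonnegative
  multipliers can only raise the value at feasible points. With \<open>q\<close> as last argument,
  partial application gives the function of \<open>q\<close> alone.\<close>

definition lagrangian ::
  "('t::finite \<Rightarrow> real^'i::finite \<Rightarrow> real) \<Rightarrow> ('i \<Rightarrow> real \<Rightarrow> real) \<Rightarrow> ('i \<Rightarrow> real^'t \<Rightarrow> real)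
   \<Rightarrow> ('i \<Rightarrow> real^'t^'m::finite) \<Rightarrow> ('i \<Rightarrow> real^'t^'m) \<Rightarrow> ('i \<Rightarrow> real^'m)
   \<Rightarrow> ('i \<Rightarrow> real^'m) \<Rightarrow> real^'t^'i \<Rightarrow> real^'t^'i \<Rightarrow> real" where
  "lagrangian P C S G H h l u q =
     objective P C S q u + (\<Sum>i\<in>UNIV. l i \<bullet> (h i - G i *v (q $ i) - H i *v (u $ i)))"

text \<open>For differentiable data this says that the gradient of the Lagrangian in
  \<open>q\<close> vanishes; \<open>S\<close>, \<open>H\<close>, \<open>h\<close> and
  \<open>u\<close> contribute only terms constant in \<open>q\<close>, hence their absence.\<close>

definition stationary ::
  "('t::finite \<Rightarrow> real^'i::finite \<Rightarrow> real) \<Rightarrow> ('i \<Rightarrow> real \<Rightarrow> real)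
   \<Rightarrow> ('i \<Rightarrow> real^'t^'m::finite) \<Rightarrow> ('i \<Rightarrow> real^'m) \<Rightarrow> real^'t^'i \<Rightarrow> bool" where
  "stationary P C G l q \<longleftrightarrow> (\<forall>i t. - partial_deriv i (P t) (column t q) + deriv (C i) (q $ i $ t)
     + l i \<bullet> column t (G i) = 0)"

lemma has_derivative_lagrangian:
  fixes P :: "'t::finite \<Rightarrow> real^'i::finite \<Rightarrow> real" and q :: "real^'t^'i"
  assumes P: "\<And>t. P t differentiable at (column t q)"
    and C: "\<And>i t. C i differentiable at (q $ i $ t)"
  shows "(lagrangian P C S G H h l u has_derivative
    (\<lambda>v. \<Sum>i\<in>UNIV. \<Sum>t\<in>UNIV. v $ i $ t * (partial_deriv i (P t) (column t q)
       - deriv (C i) (q $ i $ t) - l i \<bullet> column t (G i)))) (at q)"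
proof -
  have col: "(column t has_derivative column t) (at q)" for t
    by (intro linear_imp_has_derivative linearI) (simp_all add: column_def vec_eq_iff)
  have dP: "((\<lambda>x. P t (column t x)) has_derivative
      (\<lambda>v. \<Sum>i\<in>UNIV. v $ i $ t * partial_deriv i (P t) (column t q))) (at q)" for t
    using has_derivative_compose[OF col has_derivative_partial_deriv[OF P[of t]]]
    by (simp add: column_def)
  have ent: "((\<lambda>x. x $ i $ t) has_derivative (\<lambda>v. v $ i $ t)) (at q)" for i t
    by (intro linear_imp_has_derivative linearI) simp_all
  have "(C i has_derivative (\<lambda>s. s * deriv (C i) (q $ i $ t))) (at (q $ i $ t))" for i t
    using C[of i t]
    by (metis DERIV_deriv_iff_real_differentiable has_field_derivative_def mult_commute_abs)
  then have dC: "((\<lambda>x. C i (x $ i $ t)) has_derivative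
      (\<lambda>v. v $ i $ t * deriv (C i) (q $ i $ t))) (at q)" for i t
    using has_derivative_compose[OF ent] by blast
  \<comment> \<open>Column form of the constraint term, which exposes the coefficient of each single
    entry.\<close>
  have G: "l i \<bullet> (G i *v x) = (\<Sum>t\<in>UNIV. x $ t * (l i \<bullet> column t (G i)))" for i x
    by (simp add: matrix_mult_sum inner_sum_right scalar_mult_eq_scaleR)
  have dG: "((\<lambda>x. l i \<bullet> (h i - G i *v (x $ i) - H i *v (u $ i))) has_derivative
      (\<lambda>v. - (\<Sum>t\<in>UNIV. v $ i $ t * (l i \<bullet> column t (G i))))) (at q)" for i
    unfolding inner_diff_right G
    by (auto intro!: derivative_eq_intros ent simp: sum_negf)
  have sw: "(\<Sum>t\<in>UNIV. \<Sum>i\<in>UNIV. v $ i $ t * partial_deriv i (P t) (column t q))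
      = (\<Sum>i\<in>UNIV. \<Sum>t\<in>UNIV. v $ i $ t * partial_deriv i (P t) (column t q))" for v :: "real^'t^'i"
    by (rule sum.swap)
  show ?thesis
    unfolding lagrangian_def objective_def
    by (rule derivative_eq_intros dP dC dG refl)+
      (simp add: sw right_diff_distrib sum_subtractf sum_negf fun_eq_iff)
qed

text \<open>Each summand is a concave function of a linear image of the production (a column for
  \<open>P\<close>, an entry for \<open>- C\<close>), affine (the slacks) or constant
  (\<open>S\<close>).\<close>

lemma concave_on_lagrangian:
  fixes P :: "'t::finite \<Rightarrow> real^'i::finite \<Rightarrow> real"
  assumes P: "\<And>t. concave_on UNIV (P t)" and C: "\<And>i. convex_on UNIV (C i)"
  shows "concave_on UNIV (lagrangian P C S G H h l u)"
proof -
  have P': "convex_on UNIV (\<lambda>x. - P t x)" for t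
    using P by (simp add: concave_on_def)
  have cP: "convex_on UNIV (\<lambda>x::real^'t^'i. - P t (column t x))" for t
  proof (rule convex_onI)
    fix c :: real and x y :: "real^'t^'i" assume "0 < c" "c < 1"
    moreover have "column t ((1 - c) *\<^sub>R x + c *\<^sub>R y) = (1 - c) *\<^sub>R column t x + c *\<^sub>R column t y"
      by (simp add: column_def vec_eq_iff)
    ultimately show "- P t (column t ((1 - c) *\<^sub>R x + c *\<^sub>R y))
        \<le> (1 - c) * - P t (column t x) + c * - P t (column t y)"
      using convex_onD[OF P', of c "column t x" "column t y"] by simp
  qed simp
  have cC: "convex_on UNIV (\<lambda>x::real^'t^'i. C i (x $ i $ t))" for i t
    using convex_onD[OF C] by (intro convex_onI) auto
  have cG: "convex_on UNIV (\<lambda>x::real^'t^'i. - (l i \<bullet> (h i - G i *v (x $ i) - H i *v (u $ i))))" for i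
    by (intro convex_onI)
      (simp_all add: matrix_vector_right_distrib matrix_vector_mult_scaleR inner_simps algebra_simps)
  have eq: "(\<lambda>x. - lagrangian P C S G H h l u x) = (\<lambda>x. (\<Sum>t\<in>UNIV. - P t (column t x))
      + (\<Sum>i\<in>UNIV. \<Sum>t\<in>UNIV. C i (x $ i $ t)) + (\<Sum>i\<in>UNIV. S i (u $ i))
      + (\<Sum>i\<in>UNIV. - (l i \<bullet> (h i - G i *v (x $ i) - H i *v (u $ i)))))"
    by (simp add: lagrangian_def objective_def sum_negf fun_eq_iff)
  show ?thesis
    unfolding concave_on_def eq
    by (intro convex_on_add convex_on_sum_fun cP cC cG) (auto simp: convex_on_const)
qed

text \<open>Stationarity says that the derivative of the Lagrangian at \<open>q\<close> is zero.
  This holds at every maximiser; conversely, the tangent inequality turns a zero derivative into a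
  global maximum.\<close>

lemma stationary_iff_maximal:
  fixes P :: "'t::finite \<Rightarrow> real^'i::finite \<Rightarrow> real" and q :: "real^'t^'i"
  assumes P: "\<And>t. concave_on UNIV (P t)" "\<And>t. cont_differentiable (P t)"
    and C: "\<And>i. convex_on UNIV (C i)" "\<And>i. C i C1_differentiable_on UNIV"
  shows "stationary P C G l q \<longleftrightarrow>
    (\<forall>p. lagrangian P C S G H h l u p \<le> lagrangian P C S G H h l u q)"
proof -
  let ?L = "lagrangian P C S G H h l u"
  let ?d = "\<lambda>i t. partial_deriv i (P t) (column t q) - deriv (C i) (q $ i $ t) - l i \<bullet> column t (G i)"
  let ?D = "\<lambda>v::real^'t^'i. \<Sum>i\<in>UNIV. \<Sum>t\<in>UNIV. v $ i $ t * ?d i t"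
  have D: "(?L has_derivative ?D) (at q)"
  proof (rule has_derivative_lagrangian)
    show "P t differentiable at (column t q)" for t
      using P(2)[of t] by (simp add: cont_differentiable_def differentiable_on_def)
    show "C i differentiable at (q $ i $ t)" for i t
      using C(2)[of i] by (simp add: C1_differentiable_on_eq)
  qed
  have st: "stationary P C G l q \<longleftrightarrow> (\<forall>i t. ?d i t = 0)"
    unfolding stationary_def by (smt (verit))
  show ?thesis
  proof
    assume "stationary P C G l q"
    then have "?D = (\<lambda>v. 0)"
      using st by simp
    with D have "(?L has_derivative (\<lambda>v. 0)) (at q)" by simp
    from concave_on_below_tangent[OF concave_on_lagrangian[where P = P and C = C, OF P(1) C(1)] this]
    show "\<forall>p. ?L p \<le> ?L q" by simp
  next
    assume "\<forall>p. ?L p \<le> ?L q"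
    then have zero: "?D = (\<lambda>v. 0)"
      by (intro differential_zero_maxmin[OF _ _ D, of UNIV]) auto
    have "?d i t = 0" for i t
    proof -
      \<comment> \<open>The matrix with a single 1 at (i, t) is the test direction that isolates one
        coefficient.\<close>
      have "?D (axis i (axis t 1)) = (\<Sum>k\<in>UNIV. if k = i then ?d i t else 0)"
      proof (intro sum.cong refl)
        fix k
        show "(\<Sum>s\<in>UNIV. axis i (axis t 1) $ k $ s * ?d k s) = (if k = i then ?d i t else 0)"
          by (cases "k = i") (simp_all add: axis_def if_distrib[of "\<lambda>x. x * _"] cong: if_cong)
      qed
      also have "\<dots> = ?d i t" by simp
      finally have "?D (axis i (axis t 1)) = ?d i t" .
      from trans[OF sym[OF this] fun_cong[OF zero]] show ?thesis .
    qed
    with st show "stationary P C G l q" by blast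
  qed
qed

section \<open>Weak duality and the KKT conditions for a fixed commitment\<close>

lemma objective_le_lagrangian:
  assumes "production_feasible G H h q u" and "\<And>i. 0 \<le> l i"
  shows "objective P C S q u \<le> lagrangian P C S G H h l u q"
proof -
  have "0 \<le> l i \<bullet> (h i - G i *v (q $ i) - H i *v (u $ i))" for i
  proof -
    have "0 \<le> h i - G i *v (q $ i) - H i *v (u $ i)"
      using assms(1) by (simp add: production_feasible_def less_eq_vec_def diff_diff_eq)
    then show ?thesis
      using assms(2)[of i] by (simp add: inner_vec_def less_eq_vec_def sum_nonneg)
  qed
  then show ?thesis
    by (simp add: lagrangian_def sum_nonneg)
qed

text \<open>The stationarity and complementarity part of \<open>OS\<close> for one index j. Primal
  feasibility is contained in it, since \<open>complementary\<close> makes the slacks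
  nonnegative.\<close>

definition KKT where
  "KKT P C G H h l u q \<longleftrightarrow> stationary P C G l q \<and>
     (\<forall>i. complementary (l i) (h i - G i *v (q $ i) - H i *v (u $ i)))"

lemma KKT_feasible: "KKT P C G H h l u q \<Longrightarrow> production_feasible G H h q u"
  by (auto simp: KKT_def complementary_def production_feasible_def less_eq_vec_def algebra_simps)

lemma KKT_nonneg: "KKT P C G H h l u q \<Longrightarrow> 0 \<le> l i"
  by (simp add: KKT_def complementary_def)

lemma KKT_lagrangian: "KKT P C G H h l u q \<Longrightarrow> lagrangian P C S G H h l u q = objective P C S q u"
  by (simp add: KKT_def complementary_def lagrangian_def)

text \<open>Weak duality bounds every feasible value by the Lagrangian, which peaks at
  \<open>q\<close>, where complementarity makes it equal to the objective.\<close>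

lemma KKT_optimal:
  assumes "\<And>t. concave_on UNIV (P t)" "\<And>t. cont_differentiable (P t)"
    and "\<And>i. convex_on UNIV (C i)" "\<And>i. C i C1_differentiable_on UNIV"
    and K: "KKT P C G H h l u q"
  shows "optimal_production P C S G H h u q"
  unfolding optimal_production_def
proof (intro conjI allI impI)
  show "production_feasible G H h q u" by (rule KKT_feasible[OF K])
  fix p assume "production_feasible G H h p u"
  then have "objective P C S p u \<le> lagrangian P C S G H h l u p"
    by (rule objective_le_lagrangian) (rule KKT_nonneg[OF K])
  also have "\<dots> \<le> lagrangian P C S G H h l u q"
    using iffD1[OF stationary_iff_maximal[where P = P and C = C, OF assms(1-4)]] K unfolding KKT_def by blast
  also have "\<dots> = objective P C S q u" by (rule KKT_lagrangian[OF K])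
  finally show "objective P C S p u \<le> objective P C S q u" .
qed

text \<open>With L the Lagrangian and f the objective, L(q) = f(q) <= f(p) <= L(p) <= L(q), so all
  are equal. Then L(p) = L(q) gives stationarity of \<open>p\<close>, and L(p) = f(p) gives
  complementarity.\<close>

lemma KKT_transfer:
  assumes "\<And>t. concave_on UNIV (P t)" "\<And>t. cont_differentiable (P t)"
    and "\<And>i. convex_on UNIV (C i)" "\<And>i. C i C1_differentiable_on UNIV"
    and K: "KKT P C G H h l u q" and p: "optimal_production P C S G H h u p"
  shows "KKT P C G H h l u p"
proof -
  let ?L = "lagrangian P C S G H h l u" and ?s = "\<lambda>i. h i - G i *v (p $ i) - H i *v (u $ i)"
  have feas: "production_feasible G H h p u"
    using p by (simp add: optimal_production_def)
  have max: "?L x \<le> ?L q" for x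
    using iffD1[OF stationary_iff_maximal[where P = P and C = C, OF assms(1-4)]] K unfolding KKT_def by blast
  have "?L q = objective P C S q u" by (rule KKT_lagrangian[OF K])
  also have "\<dots> \<le> objective P C S p u"
    using p KKT_feasible[OF K] by (simp add: optimal_production_def)
  finally have q_le: "?L q \<le> objective P C S p u" .
  have le: "objective P C S p u \<le> ?L p"
    by (rule objective_le_lagrangian[OF feas KKT_nonneg[OF K]])
  have "stationary P C G l p"
    using stationary_iff_maximal[where P = P and C = C, OF assms(1-4)] max order_trans[OF q_le le]
    by (blast intro: order_trans)
  moreover have "complementary (l i) (?s i)" for i
  proof -
    have s: "0 \<le> ?s i" for i
      using feas by (simp add: production_feasible_def less_eq_vec_def diff_diff_eq)
    then have nonneg: "0 \<le> l i \<bullet> ?s i" for i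
      using KKT_nonneg[OF K, of i] by (simp add: inner_vec_def less_eq_vec_def sum_nonneg)
    \<comment> \<open>This sum is exactly the excess of \<open>?L p\<close> over the objective at
      \<open>p\<close>, which already dominates \<open>?L q\<close>.\<close>
    have "(\<Sum>i\<in>UNIV. l i \<bullet> ?s i) \<le> 0"
      using max[of p] q_le by (simp add: lagrangian_def)
    then have "(\<Sum>i\<in>UNIV. l i \<bullet> ?s i) = 0"
      using nonneg by (simp add: antisym sum_nonneg)
    then have "l i \<bullet> ?s i = 0"
      using nonneg by (simp add: sum_nonneg_eq_0_iff)
    then show ?thesis
      using s KKT_nonneg[OF K] by (simp add: complementary_def)
  qed
  ultimately show ?thesis by (simp add: KKT_def)
qed

lemma OS_iff_KKT:
  "OS P C S A b G H h J uu q u qq lam \<longleftrightarrow>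
     u \<in> commitments A b \<and> production_feasible G H h q u \<and>
     (\<forall>j\<in>{1..J}. objective P C S (qq j) (uu j) \<le> objective P C S q u \<and>
        KKT P C G H h (lam j) (uu j) (qq j))"
  unfolding OS_def KKT_def stationary_def by blast

section \<open>Production bounds and the deviation between binary commitments\<close>

lemma production_bounds:
  assumes "includes_bounds G H h qlo qhi" and "production_feasible G H h q u"
  shows "qlo i * u $ i $ t \<le> q $ i $ t" and "q $ i $ t \<le> qhi i * u $ i $ t"
  using assms unfolding includes_bounds_def production_feasible_def less_eq_vec_def by metis+

lemma deviation_nonneg:
  assumes "\<And>k s. u $ k $ s \<in> {0, 1}"
  shows "0 \<le> deviation v u i t"
proof -
  have "0 \<le> u $ k $ s" "u $ k $ s \<le> 1" for k s
    using assms[of k s] by auto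
  then show ?thesis
    unfolding deviation_def by (intro add_nonneg_nonneg sum_nonneg) auto
qed

lemma deviation_self: "deviation u u i t = 0"
proof -
  have "(\<Sum>(k, s)\<in>{(k, s). (k, s) \<noteq> (i, t) \<and> u $ k $ s = 1}. 1 - u $ k $ s) = 0"
    and "(\<Sum>(k, s)\<in>{(k, s). u $ k $ s = 0}. u $ k $ s) = 0"
    by (rule sum.neutral, auto)+
  then show ?thesis by (simp add: deviation_def)
qed

text \<open>Under these hypotheses the deviation counts the entries where \<open>v\<close> and
  \<open>u\<close> differ. One such entry exists, it is not (i, t), and it adds 1 to one of two
  nonnegative sums.\<close>

lemma deviation_ge_1:
  assumes u: "\<And>k s. u $ k $ s \<in> {0, 1}" and v: "\<And>k s. v $ k $ s \<in> {0, 1}"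
    and "v \<noteq> u" and it: "v $ i $ t = u $ i $ t"
  shows "1 \<le> deviation v u i t"
proof -
  let ?X = "{(k, s). (k, s) \<noteq> (i, t) \<and> v $ k $ s = 1}" and ?Y = "{(k, s). v $ k $ s = 0}"
  have u01: "0 \<le> u $ k $ s" "u $ k $ s \<le> 1" for k s
    using u[of k s] by auto
  obtain k s where ks: "v $ k $ s \<noteq> u $ k $ s"
    using \<open>v \<noteq> u\<close> by (auto simp: vec_eq_iff)
  have X: "0 \<le> (\<Sum>(k, s)\<in>?X. 1 - u $ k $ s)" and Y: "0 \<le> (\<Sum>(k, s)\<in>?Y. u $ k $ s)"
    using u01 by (auto intro!: sum_nonneg)
  consider "v $ k $ s = 1" "u $ k $ s = 0" | "v $ k $ s = 0" "u $ k $ s = 1"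
    using ks u[of k s] v[of k s] by auto
  then show ?thesis
  proof cases
    case 1
    then have "(k, s) \<in> ?X" using it by auto
    then have "(\<lambda>(k, s). 1 - u $ k $ s) (k, s) \<le> (\<Sum>(k, s)\<in>?X. 1 - u $ k $ s)"
      using u01 by (intro member_le_sum) auto
    with 1 Y show ?thesis by (simp add: deviation_def)
  next
    case 2
    then have "(\<lambda>(k, s). u $ k $ s) (k, s) \<le> (\<Sum>(k, s)\<in>?Y. u $ k $ s)"
      using u01 by (intro member_le_sum) auto
    with 2 X show ?thesis by (simp add: deviation_def)
  qed
qed

text \<open>For \<open>uu j = u\<close> the deviation is 0 and the inequalities force
  \<open>qq j\<close> and \<open>q\<close> to agree at committed entries. The bounds do not yield
  this, so \<open>same\<close> supplies it.\<close>

lemma linking_inequalitiesI: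
  assumes bounds: "includes_bounds G H h qlo qhi"
    and u: "u \<in> commitments A b" and uu: "\<And>j. j \<in> {1..J} \<Longrightarrow> uu j \<in> commitments A b"
    and q: "production_feasible G H h q u"
    and qq: "\<And>j. j \<in> {1..J} \<Longrightarrow> production_feasible G H h (qq j) (uu j)"
    and same: "\<And>j. j \<in> {1..J} \<Longrightarrow> uu j = u \<Longrightarrow> qq j = q"
  shows "linking_inequalities qlo qhi J uu q u qq"
  unfolding linking_inequalities_def
proof (intro allI ballI impI)
  fix t i j assume j: "j \<in> {1..J}" and uj: "uu j $ i $ t = 1"
  let ?d = "deviation (uu j) u i t"
  have u01: "u $ k $ s \<in> {0, 1}" for k s
    using u by (simp add: commitments_def)
  have v01: "uu j $ k $ s \<in> {0, 1}" for k s
    using uu[OF j] by (simp add: commitments_def)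
  note bq = production_bounds[OF bounds q, of i t]
  \<comment> \<open>The order \<open>qlo i \<le> qhi i\<close> is no assumption; it follows here
    from a feasible production at a committed entry.\<close>
  have bj: "qlo i \<le> qq j $ i $ t" "qq j $ i $ t \<le> qhi i"
    using production_bounds[OF bounds qq[OF j], of i t] uj by simp_all
  show "qq j $ i $ t - (qhi i - qlo i) * ?d - qhi i * (1 - u $ i $ t) \<le> q $ i $ t \<and>
      q $ i $ t \<le> qq j $ i $ t + (qhi i - qlo i) * ?d - qlo i * (1 - u $ i $ t)"
  proof (cases "uu j = u")
    case True
    then show ?thesis
      using same[OF j] uj deviation_self[of u] by simp
  next
    case False
    consider "u $ i $ t = 0" | "u $ i $ t = 1" using u01[of i t] by auto
    then show ?thesis
    proof cases
      \<comment> \<open>The bounds give \<open>q $ i $ t = 0\<close>; subtracting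
        \<open>qhi i\<close> makes the left side nonpositive, and subtracting \<open>qlo i\<close>
        leaves the right side nonnegative.\<close>
      case 1
      moreover have "0 \<le> (qhi i - qlo i) * ?d"
        using bj deviation_nonneg[OF u01] by (intro mult_nonneg_nonneg) auto
      ultimately show ?thesis using bq bj by auto
    next
      \<comment> \<open>Both productions lie between \<open>qlo i\<close> and \<open>qhi i\<close>,
        so they differ by at most the width of that interval, which a factor
        \<open>?d \<ge> 1\<close> only enlarges.\<close>
      case 2
      then have "1 \<le> ?d"
        using deviation_ge_1[OF u01 v01 False] uj by simp
      then have "(qhi i - qlo i) * 1 \<le> (qhi i - qlo i) * ?d"
        using bj by (intro mult_left_mono) auto
      with 2 show ?thesis using bq bj by auto
    qed
  qed
qed

text \<open>The conjuncts secure \<open>same\<close> of \<open>linking_inequalitiesI\<close> in two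
  ways: by overwriting the copy for the commitment \<open>u\<close> with \<open>q\<close>, or by
  uniqueness of the optimal production.\<close>

theorem proposition2:
  fixes P :: "'t::finite \<Rightarrow> real^'i::finite \<Rightarrow> real"
    and C :: "'i \<Rightarrow> real \<Rightarrow> real"
    and S :: "'i \<Rightarrow> real^'t \<Rightarrow> real"
    and A :: "'i \<Rightarrow> real^'t^'n::finite" and b :: "'i \<Rightarrow> real^'n"
    and G H :: "'i \<Rightarrow> real^'t^'m::finite" and h :: "'i \<Rightarrow> real^'m"
    and J :: nat and uu :: "nat \<Rightarrow> real^'t^'i"
    and qlo qhi :: "'i \<Rightarrow> real"
  assumes "\<And>t. concave_on UNIV (P t)" and "\<And>t. cont_differentiable (P t)"
    and "\<And>i. convex_on UNIV (C i)" and "\<And>i. C i C1_differentiable_on UNIV"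
    and "\<And>i. continuous_on UNIV (S i)"
    and "bij_betw uu {1..J} (commitments A b)"
    and "\<exists>q u. optimal_solution P C S A b G H h q u"
    and "includes_bounds G H h qlo qhi"
  shows "(\<forall>q u qq lam. OS P C S A b G H h J uu q u qq lam \<longrightarrow>
            (\<exists>qq'. (\<forall>j\<in>{1..J}. uu j \<noteq> u \<longrightarrow> qq' j = qq j) \<and>
                   OS P C S A b G H h J uu q u qq' lam \<and>
                   linking_inequalities qlo qhi J uu q u qq'))
       \<and> ((\<forall>j\<in>{1..J}. \<exists>\<^sub>\<le>\<^sub>1 p. optimal_production P C S G H h (uu j) p) \<longrightarrow>
            (\<forall>q u qq lam. OS P C S A b G H h J uu q u qq lam \<longrightarrow>
               linking_inequalities qlo qhi J uu q u qq))"
proof (intro conjI allI impI)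
  note KKT_opt = KKT_optimal[where P = P and C = C, OF assms(1-4)]
    and transfer = KKT_transfer[where P = P and C = C, OF assms(1-4)]
  have uu: "uu j \<in> commitments A b" if "j \<in> {1..J}" for j
    using assms(6) that by (auto simp: bij_betw_def)
  fix q u qq lam assume os: "OS P C S A b G H h J uu q u qq lam"
  have u: "u \<in> commitments A b" and q: "production_feasible G H h q u"
    and le: "\<And>j. j \<in> {1..J} \<Longrightarrow> objective P C S (qq j) (uu j) \<le> objective P C S q u"
    and K: "\<And>j. j \<in> {1..J} \<Longrightarrow> KKT P C G H h (lam j) (uu j) (qq j)"
    using os unfolding OS_iff_KKT by auto
  \<comment> \<open>The copy \<open>qq j\<close> is optimal for \<open>u\<close> by its KKT
    conditions, and the value inequality of \<open>OS\<close> at this index makes \<open>q\<close>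
    at least as good.\<close>
  have q_opt: "optimal_production P C S G H h (uu j) q" if "j \<in> {1..J}" "uu j = u" for j
    using KKT_opt[OF K[OF that(1)], where S = S] le[OF that(1)] q that(2)
    unfolding optimal_production_def by (metis order_trans)
  {
    define qq' where "qq' j = (if uu j = u then q else qq j)" for j
    \<comment> \<open>The multipliers \<open>lam\<close> survive the replacement because
      \<open>KKT_transfer\<close> keeps them fixed.\<close>
    have K': "KKT P C G H h (lam j) (uu j) (qq' j)" if "j \<in> {1..J}" for j
      using K[OF that] transfer[OF K[OF that] q_opt[OF that]] by (auto simp: qq'_def)
    have "OS P C S A b G H h J uu q u qq' lam"
      using u q le K' by (auto simp: OS_iff_KKT qq'_def)
    moreover have "linking_inequalities qlo qhi J uu q u qq'"
      using KKT_feasible[OF K']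
      by (intro linking_inequalitiesI[OF assms(8) u uu q]) (auto simp: qq'_def)
    ultimately show "\<exists>qq'. (\<forall>j\<in>{1..J}. uu j \<noteq> u \<longrightarrow> qq' j = qq j) \<and>
        OS P C S A b G H h J uu q u qq' lam \<and> linking_inequalities qlo qhi J uu q u qq'"
      by (intro exI[of _ qq']) (simp add: qq'_def)
  }
  assume unique: "\<forall>j\<in>{1..J}. \<exists>\<^sub>\<le>\<^sub>1 p. optimal_production P C S G H h (uu j) p"
  have "qq j = q" if "j \<in> {1..J}" "uu j = u" for j
    using unique that(1) KKT_opt[OF K[OF that(1)], where S = S] q_opt[OF that]
    by (auto dest: Uniq_D)
  then show "linking_inequalities qlo qhi J uu q u qq"
    using KKT_feasible[OF K] by (intro linking_inequalitiesI[OF assms(8) u uu q])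
qed

end
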